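(* Let $\ell_i=(\mathrm{get}^{\ell_i},\mathrm{put}^{\ell_i})$, $i=1,2$, be ala-lenses from $\mathbf{A}_i$ to $\mathbf{B}_i$ with parameter categories $\mathbf{P}_i$, and let $\ell_1\|\ell_2$ be their parallel composition, an ala-lens from $\mathbf{A}_1\times\mathbf{A}_2$ to $\mathbf{B}_1\times\mathbf{B}_2$ with parameter category $\mathbf{P}_1\times\mathbf{P}_2$. If $\ell_1$ and $\ell_2$ are both well-behaved, then $\ell_1\|\ell_2$ is well-behaved.
   Context: Notation: for a category $\mathbf{X}$, $|\mathbf{X}|$ is its class of objects; composition of arrows is written in diagrammatic order $u;u'$. Parameterized functor: given categories $\mathbf{S},\mathbf{T},\mathbf{P}$, a functor $\mathrm{get}:\mathbf{P}\to[\mathbf{S},\mathbf{T}]$. For $p\in|\mathbf{P}|$ write $\mathrm{get}_p=\mathrm{get}(p)$, $S_p=\mathrm{get}_p(S)$; for $e:p\to p'$, $\mathrm{get}_e:\mathrm{get}_p\Rightarrow\mathrm{get}_{p'}$ with components $e_S$, and for $u:S\to S'$, $u.\mathrm{get}_e:=e_S;\mathrm{get}_{p'}(u):S_p\to S'_{p'}$. Ala-lens from $\mathbf{S}$ to $\mathbf{T}$ with parameter category $\mathbf{P}$: a pair $(\mathrm{get},\mathrm{put})$ with $\mathrm{get}:\mathbf{P}\to[\mathbf{S},\mathbf{T}]$ and three families indexed by $(p,S)\in|\mathbf{P}|\times|\mathbf{S}|$ assigning to every $v:S_p\to T'$ in $\mathbf{T}$ arrows $\mathrm{put}^{\mathrm{upd}}_{p,S}(v):p\to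 p'$, $\mathrm{put}^{\mathrm{req}}_{p,S}(v):S\to S'$, and $\mathrm{put}^{\mathrm{self}}_{p,S}(v)=:v^@:T'\to\mathrm{get}_{p'}(S')$. Well-behaved: for all $p,S$ and $v:S_p\to T'$: (Stability) the three puts send $\mathrm{id}_{S_p}$ to $\mathrm{id}_p$, $\mathrm{id}_S$, $\mathrm{id}_{S_p}$ respectively; (Putget) $(\mathrm{put}^{\mathrm{req}}_{p,S}(v)).\mathrm{get}_e=v;v^@$ where $e=\mathrm{put}^{\mathrm{upd}}_{p,S}(v)$. Parallel composition $\ell_1\|\ell_2$: parameter category $\mathbf{P}_1\times\mathbf{P}_2$; $\mathrm{get}_{(p_1,p_2)}=\mathrm{get}^{\ell_1}_{p_1}\times\mathrm{get}^{\ell_2}_{p_2}$ (and componentwise on parameter arrows); for $(S_1,S_2)$ and $(v_1,v_2):(\mathrm{get}^{\ell_1}_{p_1}(S_1),\mathrm{get}^{\ell_2}_{p_2}(S_2))\to(B'_1,B'_2)$, each put operation $x\in\{\mathrm{upd},\mathrm{req},\mathrm{self}\}$ is defined componentwise: $\mathrm{put}^{x}_{(p_1,p_2),(S_1,S_2)}(v_1,v_2)=(\mathrm{put}^{\ell_1,x}_{p_1,S_1}(v_1),\mathrm{put}^{\ell_2,x}_{p_2,S_2}(v_2))$. *)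

theory Defs
  imports "HOL-Library.FuncSet"
begin

text \<open>Composition \<open>Comp\<close> is in diagrammatic order.\<close>

record ('o, 'a) cat =
  Obj :: "'o set"
  Arr :: "'a set"
  Dom :: "'a \<Rightarrow> 'o"
  Cod :: "'a \<Rightarrow> 'o"
  Ide :: "'o \<Rightarrow> 'a"
  Comp :: "'a \<Rightarrow> 'a \<Rightarrow> 'a" (infixl ";;\<index>" 70)

definition Hom :: "('o, 'a) cat \<Rightarrow> 'o \<Rightarrow> 'o \<Rightarrow> 'a set" where
  "Hom C X Y = {u \<in> Arr C. Dom C u = X \<and> Cod C u = Y}"

locale category =
  fixes C :: "('o, 'a) cat" (structure)
  assumes Dom_in_Obj: "u \<in> Arr C \<Longrightarrow> Dom C u \<in> Obj C"
    and Cod_in_Obj: "u \<in> Arr C \<Longrightarrow> Cod C u \<in> Obj C"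
    and Id_in_Hom: "X \<in> Obj C \<Longrightarrow> Ide C X \<in> Hom C X X"
    and Comp_in_Hom: "u \<in> Hom C X Y \<Longrightarrow> v \<in> Hom C Y Z \<Longrightarrow> u ;; v \<in> Hom C X Z"
    and Id_left: "u \<in> Hom C X Y \<Longrightarrow> Ide C X ;; u = u"
    and Id_right: "u \<in> Hom C X Y \<Longrightarrow> u ;; Ide C Y = u"
    and Comp_assoc: "u \<in> Hom C W X \<Longrightarrow> v \<in> Hom C X Y \<Longrightarrow> w \<in> Hom C Y Z \<Longrightarrow>
      (u ;; v) ;; w = u ;; (v ;; w)"

definition prod_cat :: "('o1, 'a1) cat \<Rightarrow> ('o2, 'a2) cat \<Rightarrow> ('o1 \<times> 'o2, 'a1 \<times> 'a2) cat"
  (infixr "\<times>\<^sub>C" 80) where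
  "C \<times>\<^sub>C D = \<lparr>
     Obj = Obj C \<times> Obj D,
     Arr = Arr C \<times> Arr D,
     Dom = (\<lambda>(u, v). (Dom C u, Dom D v)),
     Cod = (\<lambda>(u, v). (Cod C u, Cod D v)),
     Ide = (\<lambda>(X, Y). (Ide C X, Ide D Y)),
     Comp = (\<lambda>(u, v) (u', v'). (u ;;\<^bsub>C\<^esub> u', v ;;\<^bsub>D\<^esub> v')) \<rparr>"

text \<open>
  Functors are objects and natural transformations are arrows of the functor category, so equality
  of their representations must be the mathematical one. Hence all their maps are required to be
  extensional, i.e. \<open>undefined\<close> outside the carriers.
\<close>

record ('o, 'a, 'o', 'a') fctr =
  FObj :: "'o \<Rightarrow> 'o'"
  FArr :: "'a \<Rightarrow> 'a'"

locale category_functor = source: category C + target: category D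
  for C :: "('o, 'a) cat" and D :: "('o', 'a') cat" +
  fixes F :: "('o, 'a, 'o', 'a') fctr"
  assumes FObj_in_PiE: "FObj F \<in> Obj C \<rightarrow>\<^sub>E Obj D"
    and FArr_in_PiE: "FArr F \<in> Arr C \<rightarrow>\<^sub>E Arr D"
    and FArr_in_Hom: "u \<in> Hom C X Y \<Longrightarrow> FArr F u \<in> Hom D (FObj F X) (FObj F Y)"
    and FArr_Id: "X \<in> Obj C \<Longrightarrow> FArr F (Ide C X) = Ide D (FObj F X)"
    and FArr_Comp: "u \<in> Hom C X Y \<Longrightarrow> v \<in> Hom C Y Z \<Longrightarrow>
      FArr F (u ;;\<^bsub>C\<^esub> v) = FArr F u ;;\<^bsub>D\<^esub> FArr F v"

record ('o, 'a, 'o', 'a') ntrans =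
  Src :: "('o, 'a, 'o', 'a') fctr"
  Trg :: "('o, 'a, 'o', 'a') fctr"
  Component :: "'o \<Rightarrow> 'a'"

locale natural_transformation =
  source: category_functor C D "Src \<theta>" + target: category_functor C D "Trg \<theta>"
  for C :: "('o, 'a) cat" and D :: "('o', 'a') cat" and \<theta> :: "('o, 'a, 'o', 'a') ntrans" +
  assumes Component_extensional: "Component \<theta> \<in> extensional (Obj C)"
    and Component_in_Hom: "X \<in> Obj C \<Longrightarrow>
      Component \<theta> X \<in> Hom D (FObj (Src \<theta>) X) (FObj (Trg \<theta>) X)"
    and natural: "u \<in> Hom C X Y \<Longrightarrow>
      FArr (Src \<theta>) u ;;\<^bsub>D\<^esub> Component \<theta> Y = Component \<theta> X ;;\<^bsub>D\<^esub> FArr (Trg \<theta>) u"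

definition functor_cat :: "('o, 'a) cat \<Rightarrow> ('o', 'a') cat \<Rightarrow>
    (('o, 'a, 'o', 'a') fctr, ('o, 'a, 'o', 'a') ntrans) cat" where
  "functor_cat C D = \<lparr>
     Obj = {F. category_functor C D F},
     Arr = {\<theta>. natural_transformation C D \<theta>},
     Dom = Src,
     Cod = Trg,
     Ide = (\<lambda>F. \<lparr> Src = F, Trg = F, Component = (\<lambda>X\<in>Obj C. Ide D (FObj F X)) \<rparr>),
     Comp = (\<lambda>\<theta> \<eta>. \<lparr> Src = Src \<theta>, Trg = Trg \<eta>,
       Component = (\<lambda>X\<in>Obj C. Component \<theta> X ;;\<^bsub>D\<^esub> Component \<eta> X) \<rparr>) \<rparr>"

definition prod_fctr :: "('o1, 'a1) cat \<Rightarrow> ('o2, 'a2) cat \<Rightarrow>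
    ('o1, 'a1, 'o1', 'a1') fctr \<Rightarrow> ('o2, 'a2, 'o2', 'a2') fctr \<Rightarrow>
    ('o1 \<times> 'o2, 'a1 \<times> 'a2, 'o1' \<times> 'o2', 'a1' \<times> 'a2') fctr" where
  "prod_fctr C1 C2 F1 F2 = \<lparr>
     FObj = (\<lambda>(X1, X2) \<in> Obj (C1 \<times>\<^sub>C C2). (FObj F1 X1, FObj F2 X2)),
     FArr = (\<lambda>(u1, u2) \<in> Arr (C1 \<times>\<^sub>C C2). (FArr F1 u1, FArr F2 u2)) \<rparr>"

definition prod_ntrans :: "('o1, 'a1) cat \<Rightarrow> ('o2, 'a2) cat \<Rightarrow>
    ('o1, 'a1, 'o1', 'a1') ntrans \<Rightarrow> ('o2, 'a2, 'o2', 'a2') ntrans \<Rightarrow>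
    ('o1 \<times> 'o2, 'a1 \<times> 'a2, 'o1' \<times> 'o2', 'a1' \<times> 'a2') ntrans" where
  "prod_ntrans C1 C2 \<theta>1 \<theta>2 = \<lparr>
     Src = prod_fctr C1 C2 (Src \<theta>1) (Src \<theta>2),
     Trg = prod_fctr C1 C2 (Trg \<theta>1) (Trg \<theta>2),
     Component = (\<lambda>(X1, X2) \<in> Obj (C1 \<times>\<^sub>C C2). (Component \<theta>1 X1, Component \<theta>2 X2)) \<rparr>"

text \<open>
  The type variables are, in order, those of objects and arrows of the parameter, the source and
  the target category. The puts take the parameter \<open>p\<close>, the source object \<open>X\<close> and the arrow \<open>v\<close>
  out of \<open>X\<^sub>p\<close>; the codomain of \<open>v\<close> is determined by \<open>v\<close>. Values of the puts on other arguments
  are irrelevant.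
\<close>

record ('po, 'pa, 'so, 'sa, 'to, 'ta) lens =
  get :: "('po, 'pa, ('so, 'sa, 'to, 'ta) fctr, ('so, 'sa, 'to, 'ta) ntrans) fctr"
  put_upd :: "'po \<Rightarrow> 'so \<Rightarrow> 'ta \<Rightarrow> 'pa"
  put_req :: "'po \<Rightarrow> 'so \<Rightarrow> 'ta \<Rightarrow> 'sa"
  put_self :: "'po \<Rightarrow> 'so \<Rightarrow> 'ta \<Rightarrow> 'ta"

abbreviation get_obj :: "('po, 'pa, 'so, 'sa, 'to, 'ta) lens \<Rightarrow> 'po \<Rightarrow> 'so \<Rightarrow> 'to" where
  "get_obj l p X \<equiv> FObj (FObj (get l) p) X"

text \<open>The arrow written \<open>u.get\<^sub>e\<close>, i.e. \<open>e\<^sub>X ; get\<^sub>p\<^sub>'(u)\<close> for \<open>e : p \<rightarrow> p'\<close> and \<open>u : X \<rightarrow> X'\<close>.\<close>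

definition get_along :: "('po, 'pa) cat \<Rightarrow> ('so, 'sa) cat \<Rightarrow> ('to, 'ta) cat \<Rightarrow>
    ('po, 'pa, 'so, 'sa, 'to, 'ta) lens \<Rightarrow> 'pa \<Rightarrow> 'sa \<Rightarrow> 'ta" where
  "get_along P S T l e u =
     Component (FArr (get l) e) (Dom S u) ;;\<^bsub>T\<^esub> FArr (FObj (get l) (Cod P e)) u"

locale ala_lens = category P + category S + category T +
  get: category_functor P "functor_cat S T" "get l"
  for P :: "('po, 'pa) cat" and S :: "('so, 'sa) cat" and T :: "('to, 'ta) cat"
    and l :: "('po, 'pa, 'so, 'sa, 'to, 'ta) lens" +
  assumes put_upd_Arr: "p \<in> Obj P \<Longrightarrow> X \<in> Obj S \<Longrightarrow> v \<in> Hom T (get_obj l p X) Y' \<Longrightarrow>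
      put_upd l p X v \<in> Arr P \<and> Dom P (put_upd l p X v) = p"
    and put_req_Arr: "p \<in> Obj P \<Longrightarrow> X \<in> Obj S \<Longrightarrow> v \<in> Hom T (get_obj l p X) Y' \<Longrightarrow>
      put_req l p X v \<in> Arr S \<and> Dom S (put_req l p X v) = X"
    and put_self_in_Hom: "p \<in> Obj P \<Longrightarrow> X \<in> Obj S \<Longrightarrow> v \<in> Hom T (get_obj l p X) Y' \<Longrightarrow>
      put_self l p X v \<in>
        Hom T Y' (get_obj l (Cod P (put_upd l p X v)) (Cod S (put_req l p X v)))"

locale well_behaved_ala_lens = ala_lens P S T l
  for P :: "('po, 'pa) cat" and S :: "('so, 'sa) cat" and T :: "('to, 'ta) cat"
    and l :: "('po, 'pa, 'so, 'sa, 'to, 'ta) lens" +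
  assumes stability_upd: "p \<in> Obj P \<Longrightarrow> X \<in> Obj S \<Longrightarrow>
      put_upd l p X (Ide T (get_obj l p X)) = Ide P p"
    and stability_req: "p \<in> Obj P \<Longrightarrow> X \<in> Obj S \<Longrightarrow>
      put_req l p X (Ide T (get_obj l p X)) = Ide S X"
    and stability_self: "p \<in> Obj P \<Longrightarrow> X \<in> Obj S \<Longrightarrow>
      put_self l p X (Ide T (get_obj l p X)) = Ide T (get_obj l p X)"
    and putget: "p \<in> Obj P \<Longrightarrow> X \<in> Obj S \<Longrightarrow> v \<in> Hom T (get_obj l p X) Y' \<Longrightarrow>
      get_along P S T l (put_upd l p X v) (put_req l p X v) = v ;;\<^bsub>T\<^esub> put_self l p X v"

definition par_lens :: "('po1, 'pa1) cat \<Rightarrow> ('po2, 'pa2) cat \<Rightarrow>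
    ('so1, 'sa1) cat \<Rightarrow> ('so2, 'sa2) cat \<Rightarrow>
    ('po1, 'pa1, 'so1, 'sa1, 'to1, 'ta1) lens \<Rightarrow> ('po2, 'pa2, 'so2, 'sa2, 'to2, 'ta2) lens \<Rightarrow>
    ('po1 \<times> 'po2, 'pa1 \<times> 'pa2, 'so1 \<times> 'so2, 'sa1 \<times> 'sa2, 'to1 \<times> 'to2, 'ta1 \<times> 'ta2) lens" where
  "par_lens P1 P2 S1 S2 l1 l2 = \<lparr>
     get = \<lparr>
       FObj = (\<lambda>(p1, p2) \<in> Obj (P1 \<times>\<^sub>C P2).
         prod_fctr S1 S2 (FObj (get l1) p1) (FObj (get l2) p2)),
       FArr = (\<lambda>(e1, e2) \<in> Arr (P1 \<times>\<^sub>C P2).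
         prod_ntrans S1 S2 (FArr (get l1) e1) (FArr (get l2) e2)) \<rparr>,
     put_upd = (\<lambda>(p1, p2) (X1, X2) (v1, v2). (put_upd l1 p1 X1 v1, put_upd l2 p2 X2 v2)),
     put_req = (\<lambda>(p1, p2) (X1, X2) (v1, v2). (put_req l1 p1 X1 v1, put_req l2 p2 X2 v2)),
     put_self = (\<lambda>(p1, p2) (X1, X2) (v1, v2). (put_self l1 p1 X1 v1, put_self l2 p2 X2 v2)) \<rparr>"

end

theory Submission
  imports Defs
begin

text \<open>Everything in a product category happens coordinate by coordinate: hom-sets, identities
  and composites are pairs, and so are the three puts of the parallel lens and the arrow
  \<open>u.get\<close> along a parameter arrow \<open>e\<close>. Each Stability or Putget equation
  of the composite is therefore the pair of the same equations of the two factors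
  (\<open>well_behaved_par_lens\<close>; \<open>get_along_par_lens\<close> splits the left side of
  Putget).

  Most of the work is in showing that the composite is an ala-lens at all
  (\<open>ala_lens_par_lens\<close>), because its get must be a functor into a functor category.
  This rests on three facts: functor categories are categories
  (\<open>category_functor_cat\<close>); products of functors and of natural transformations are
  again functors and natural transformations (\<open>category_functor_prod\<close>,
  \<open>natural_transformation_prod\<close>); and taking products of natural transformations
  respects identities and vertical composition (\<open>prod_ntrans_Ide\<close>,
  \<open>prod_ntrans_Comp\<close>). Together they give \<open>category_functor_get_par_lens\<close>.

  Extensionality of the maps acts in two ways. Natural transformations are equal as soon as they
  agree on objects and have the same source and target; in return, a product functor or
  transformation can be evaluated only at arguments known to lie in the carriers, so such
  memberships are carried through all the calculations.\<close>

lemma Hom_iff: "u \<in> Hom C X Y \<longleftrightarrow> u \<in> Arr C \<and> Dom C u = X \<and> Cod C u = Y"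
  by (simp add: Hom_def)

lemma prod_cat_simps [simp]:
  "Obj (C \<times>\<^sub>C D) = Obj C \<times> Obj D"
  "Arr (C \<times>\<^sub>C D) = Arr C \<times> Arr D"
  "Dom (C \<times>\<^sub>C D) (u, v) = (Dom C u, Dom D v)"
  "Cod (C \<times>\<^sub>C D) (u, v) = (Cod C u, Cod D v)"
  "Ide (C \<times>\<^sub>C D) (X, Y) = (Ide C X, Ide D Y)"
  "(u, v) ;;\<^bsub>C \<times>\<^sub>C D\<^esub> (u', v') = (u ;;\<^bsub>C\<^esub> u', v ;;\<^bsub>D\<^esub> v')"
  by (simp_all add: prod_cat_def)

lemma Hom_prod_cat [simp]:
  "(u, v) \<in> Hom (C \<times>\<^sub>C D) (X, X') (Y, Y') \<longleftrightarrow> u \<in> Hom C X Y \<and> v \<in> Hom D X' Y'"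
  by (auto simp: Hom_iff)

lemma category_prod_cat:
  assumes "category C" and "category D"
  shows "category (C \<times>\<^sub>C D)"
proof -
  interpret C: category C by fact
  interpret D: category D by fact
  show ?thesis
    by (unfold_locales; clarsimp simp: split_paired_all)
      (simp_all add: C.Dom_in_Obj D.Dom_in_Obj C.Cod_in_Obj D.Cod_in_Obj C.Id_in_Hom D.Id_in_Hom
        C.Id_left D.Id_left C.Id_right D.Id_right C.Comp_in_Hom D.Comp_in_Hom
        C.Comp_assoc D.Comp_assoc)
qed

section \<open>The functor category\<close>

lemma functor_cat_simps [simp]:
  "Obj (functor_cat C D) = {F. category_functor C D F}"
  "Arr (functor_cat C D) = {\<theta>. natural_transformation C D \<theta>}"
  "Dom (functor_cat C D) = Src"
  "Cod (functor_cat C D) = Trg"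
  "Ide (functor_cat C D) F =
    \<lparr> Src = F, Trg = F, Component = (\<lambda>X\<in>Obj C. Ide D (FObj F X)) \<rparr>"
  "\<theta> ;;\<^bsub>functor_cat C D\<^esub> \<eta> = \<lparr> Src = Src \<theta>, Trg = Trg \<eta>,
    Component = (\<lambda>X\<in>Obj C. Component \<theta> X ;;\<^bsub>D\<^esub> Component \<eta> X) \<rparr>"
  by (simp_all add: functor_cat_def)

lemma natural_transformation_Ide:
  assumes "category_functor C D F"
  shows "natural_transformation C D (Ide (functor_cat C D) F)"
proof -
  interpret F: category_functor C D F by fact
  have obj: "X \<in> Obj C" "Y \<in> Obj C" if "u \<in> Hom C X Y" for u X Y
    using that F.source.Dom_in_Obj F.source.Cod_in_Obj by (auto simp: Hom_iff)
  have "Ide D (FObj F X) \<in> Hom D (FObj F X) (FObj F X)" if "X \<in> Obj C" for X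
    using F.target.Id_in_Hom F.FObj_in_PiE that by blast
  then show ?thesis
    by (intro natural_transformation.intro natural_transformation_axioms.intro)
      (simp_all add: F.category_functor_axioms obj
        F.target.Id_left[OF F.FArr_in_Hom] F.target.Id_right[OF F.FArr_in_Hom])
qed

text \<open>Vertical composition: the naturality squares of \<theta> and \<eta> at the same arrow
  are pasted along their common edge, the image of that arrow under the middle functor.\<close>

lemma natural_transformation_Comp:
  assumes "natural_transformation C D \<theta>" and "natural_transformation C D \<eta>"
    and Trg: "Trg \<theta> = Src \<eta>"
  shows "natural_transformation C D (\<theta> ;;\<^bsub>functor_cat C D\<^esub> \<eta>)"
proof -
  interpret \<theta>: natural_transformation C D \<theta> by fact
  interpret \<eta>: natural_transformation C D \<eta> by fact
  have "FArr (Src \<theta>) u ;;\<^bsub>D\<^esub> (Component \<theta> Y ;;\<^bsub>D\<^esub> Component \<eta> Y) =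
      (Component \<theta> X ;;\<^bsub>D\<^esub> Component \<eta> X) ;;\<^bsub>D\<^esub> FArr (Trg \<eta>) u"
    if u: "u \<in> Hom C X Y" and X: "X \<in> Obj C" and Y: "Y \<in> Obj C" for u X Y
  proof -
    \<comment> \<open>Rewriting the middle functor as \<open>Src \<eta>\<close> makes the hom-sets
      of the two components composable syntactically, as \<open>Comp_assoc\<close> requires.\<close>
    note \<theta> = \<theta>.Component_in_Hom[unfolded Trg] and \<eta> = \<eta>.Component_in_Hom
    note assoc = \<theta>.source.target.Comp_assoc
    have "FArr (Src \<theta>) u ;;\<^bsub>D\<^esub> (Component \<theta> Y ;;\<^bsub>D\<^esub> Component \<eta> Y) =
        (FArr (Src \<theta>) u ;;\<^bsub>D\<^esub> Component \<theta> Y) ;;\<^bsub>D\<^esub> Component \<eta> Y"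
      by (rule assoc[OF \<theta>.source.FArr_in_Hom[OF u] \<theta>[OF Y] \<eta>[OF Y], symmetric])
    also have "\<dots> = (Component \<theta> X ;;\<^bsub>D\<^esub> FArr (Src \<eta>) u) ;;\<^bsub>D\<^esub> Component \<eta> Y"
      by (simp add: \<theta>.natural[OF u] Trg)
    also have "\<dots> = Component \<theta> X ;;\<^bsub>D\<^esub> (FArr (Src \<eta>) u ;;\<^bsub>D\<^esub> Component \<eta> Y)"
      by (rule assoc[OF \<theta>[OF X] \<eta>.source.FArr_in_Hom[OF u] \<eta>[OF Y]])
    also have "\<dots> = Component \<theta> X ;;\<^bsub>D\<^esub> (Component \<eta> X ;;\<^bsub>D\<^esub> FArr (Trg \<eta>) u)"
      by (simp add: \<eta>.natural[OF u])
    also have "\<dots> = (Component \<theta> X ;;\<^bsub>D\<^esub> Component \<eta> X) ;;\<^bsub>D\<^esub> FArr (Trg \<eta>) u"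
      by (rule assoc[OF \<theta>[OF X] \<eta>[OF X] \<eta>.target.FArr_in_Hom[OF u], symmetric])
    finally show ?thesis .
  qed
  moreover have "X \<in> Obj C" "Y \<in> Obj C" if "u \<in> Hom C X Y" for u X Y
    using that \<theta>.source.source.Dom_in_Obj \<theta>.source.source.Cod_in_Obj by (auto simp: Hom_iff)
  moreover have "Component \<theta> X ;;\<^bsub>D\<^esub> Component \<eta> X \<in>
      Hom D (FObj (Src \<theta>) X) (FObj (Trg \<eta>) X)" if "X \<in> Obj C" for X
    by (rule \<theta>.source.target.Comp_in_Hom
        [OF \<theta>.Component_in_Hom[OF that, unfolded Trg] \<eta>.Component_in_Hom[OF that]])
  ultimately show ?thesis
    by (intro natural_transformation.intro natural_transformation_axioms.intro)
      (simp_all add: \<theta>.source.category_functor_axioms \<eta>.target.category_functor_axioms)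
qed

text \<open>Extensionality on a common carrier settles the values off \<open>A\<close>, so only the
  components on \<open>A\<close> need comparing. All equations between natural transformations below
  go through this rule.\<close>

lemma ntrans_eqI:
  fixes \<theta> \<eta> :: "('o, 'a, 'o', 'a') ntrans"
  assumes "Src \<theta> = Src \<eta>" and "Trg \<theta> = Trg \<eta>"
    and "Component \<theta> \<in> extensional A" and "Component \<eta> \<in> extensional A"
    and "\<And>X. X \<in> A \<Longrightarrow> Component \<theta> X = Component \<eta> X"
  shows "\<theta> = \<eta>"
  using assms extensionalityI[of "Component \<theta>" A "Component \<eta>"] by (cases \<theta>, cases \<eta>) auto

text \<open>The laws of the functor category are those of \<open>D\<close> at each object of
  \<open>C\<close>. The identity laws hold as strict equations because composition restricts
  components to \<open>Obj C\<close> and every natural transformation is already extensional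
  there.\<close>

lemma category_functor_cat:
  fixes C :: "('o, 'a) cat" and D :: "('o', 'a') cat"
  assumes "category C" and "category D"
  shows "category (functor_cat C D)"
proof -
  interpret D: category D by fact
  \<comment> \<open>Stated for an arbitrary \<theta>, since the category laws below quantify over up
    to three transformations at once.\<close>
  have src: "category_functor C D (Src \<theta>)" and trg: "category_functor C D (Trg \<theta>)"
    and ext: "Component \<theta> \<in> extensional (Obj C)"
    and hom: "X \<in> Obj C \<Longrightarrow> Component \<theta> X \<in> Hom D (FObj (Src \<theta>) X) (FObj (Trg \<theta>) X)"
    if "natural_transformation C D \<theta>" for \<theta> :: "('o, 'a, 'o', 'a') ntrans" and X
    using that by (simp_all add: natural_transformation.axioms
        natural_transformation.Component_extensional natural_transformation.Component_in_Hom)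
  show ?thesis
  proof
    show "Ide (functor_cat C D) F \<in> Hom (functor_cat C D) F F" if "F \<in> Obj (functor_cat C D)" for F
      using that natural_transformation_Ide[of C D F] by (simp add: Hom_iff)
    show "\<theta> ;;\<^bsub>functor_cat C D\<^esub> \<eta> \<in> Hom (functor_cat C D) F H"
      if "\<theta> \<in> Hom (functor_cat C D) F G" "\<eta> \<in> Hom (functor_cat C D) G H" for \<theta> \<eta> F G H
      using that natural_transformation_Comp[of C D \<theta> \<eta>] by (simp add: Hom_iff)
    show "Ide (functor_cat C D) F ;;\<^bsub>functor_cat C D\<^esub> \<theta> = \<theta>"
      if "\<theta> \<in> Hom (functor_cat C D) F G" for \<theta> F G
      using that by (intro ntrans_eqI[of _ _ "Obj C"]) (auto simp: Hom_iff ext D.Id_left[OF hom])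
    show "\<theta> ;;\<^bsub>functor_cat C D\<^esub> Ide (functor_cat C D) G = \<theta>"
      if "\<theta> \<in> Hom (functor_cat C D) F G" for \<theta> F G
      using that by (intro ntrans_eqI[of _ _ "Obj C"]) (auto simp: Hom_iff ext D.Id_right[OF hom])
    show "(\<theta> ;;\<^bsub>functor_cat C D\<^esub> \<eta>) ;;\<^bsub>functor_cat C D\<^esub> \<zeta> =
        \<theta> ;;\<^bsub>functor_cat C D\<^esub> (\<eta> ;;\<^bsub>functor_cat C D\<^esub> \<zeta>)"
      if "\<theta> \<in> Hom (functor_cat C D) F G" "\<eta> \<in> Hom (functor_cat C D) G H"
        "\<zeta> \<in> Hom (functor_cat C D) H K" for \<theta> \<eta> \<zeta> F G H K
    proof (rule ntrans_eqI[of _ _ "Obj C"])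
      fix X assume X: "X \<in> Obj C"
      have "Component \<theta> X \<in> Hom D (FObj F X) (FObj G X)"
        "Component \<eta> X \<in> Hom D (FObj G X) (FObj H X)" "Component \<zeta> X \<in> Hom D (FObj H X) (FObj K X)"
        using that hom[OF _ X] by (auto simp: Hom_iff)
      from D.Comp_assoc[OF this] X show "Component ((\<theta> ;;\<^bsub>functor_cat C D\<^esub> \<eta>) ;;\<^bsub>functor_cat C D\<^esub> \<zeta>) X =
          Component (\<theta> ;;\<^bsub>functor_cat C D\<^esub> (\<eta> ;;\<^bsub>functor_cat C D\<^esub> \<zeta>)) X"
        by simp
    qed simp_all
  qed (simp_all add: src trg)
qed

section \<open>Products of functors and natural transformations\<close>

lemma FObj_prod_fctr [simp]:
  "X1 \<in> Obj C1 \<Longrightarrow> X2 \<in> Obj C2 \<Longrightarrow>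
    FObj (prod_fctr C1 C2 F1 F2) (X1, X2) = (FObj F1 X1, FObj F2 X2)"
  by (simp add: prod_fctr_def)

lemma FArr_prod_fctr [simp]:
  "u1 \<in> Arr C1 \<Longrightarrow> u2 \<in> Arr C2 \<Longrightarrow>
    FArr (prod_fctr C1 C2 F1 F2) (u1, u2) = (FArr F1 u1, FArr F2 u2)"
  by (simp add: prod_fctr_def)

lemma prod_ntrans_simps [simp]:
  "Src (prod_ntrans C1 C2 \<theta>1 \<theta>2) = prod_fctr C1 C2 (Src \<theta>1) (Src \<theta>2)"
  "Trg (prod_ntrans C1 C2 \<theta>1 \<theta>2) = prod_fctr C1 C2 (Trg \<theta>1) (Trg \<theta>2)"
  "Component (prod_ntrans C1 C2 \<theta>1 \<theta>2) \<in> extensional (Obj C1 \<times> Obj C2)"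
  "X1 \<in> Obj C1 \<Longrightarrow> X2 \<in> Obj C2 \<Longrightarrow>
    Component (prod_ntrans C1 C2 \<theta>1 \<theta>2) (X1, X2) = (Component \<theta>1 X1, Component \<theta>2 X2)"
  by (simp_all add: prod_ntrans_def)

context category
begin

text \<open>This lemma, \<open>Comp_in_Arr\<close> and \<open>Id_in_Arr\<close> serve to discharge
  the carrier conditions of the evaluation rules for product functors, product transformations and
  the parallel get.\<close>

lemma Hom_in_Obj:
  assumes "u \<in> Hom C X Y"
  shows "u \<in> Arr C" and "X \<in> Obj C" and "Y \<in> Obj C"
  using assms Dom_in_Obj Cod_in_Obj by (auto simp: Hom_iff)

lemma Comp_in_Arr: "u \<in> Hom C X Y \<Longrightarrow> v \<in> Hom C Y Z \<Longrightarrow> u ;; v \<in> Arr C"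
  using Comp_in_Hom by (auto simp: Hom_iff)

lemma Id_in_Arr: "X \<in> Obj C \<Longrightarrow> Ide C X \<in> Arr C"
  using Id_in_Hom by (auto simp: Hom_iff)

end

lemma category_functor_prod:
  assumes "category_functor C1 D1 F1" and "category_functor C2 D2 F2"
  shows "category_functor (C1 \<times>\<^sub>C C2) (D1 \<times>\<^sub>C D2) (prod_fctr C1 C2 F1 F2)"
proof -
  interpret F1: category_functor C1 D1 F1 by fact
  interpret F2: category_functor C2 D2 F2 by fact
  interpret C: category "C1 \<times>\<^sub>C C2"
    by (intro category_prod_cat F1.source.category_axioms F2.source.category_axioms)
  interpret D: category "D1 \<times>\<^sub>C D2"
    by (intro category_prod_cat F1.target.category_axioms F2.target.category_axioms)
  show ?thesis
  proof
    show "FObj (prod_fctr C1 C2 F1 F2) \<in> Obj (C1 \<times>\<^sub>C C2) \<rightarrow>\<^sub>E Obj (D1 \<times>\<^sub>C D2)"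
      using F1.FObj_in_PiE F2.FObj_in_PiE by (auto simp: prod_fctr_def)
    show "FArr (prod_fctr C1 C2 F1 F2) \<in> Arr (C1 \<times>\<^sub>C C2) \<rightarrow>\<^sub>E Arr (D1 \<times>\<^sub>C D2)"
      using F1.FArr_in_PiE F2.FArr_in_PiE by (auto simp: prod_fctr_def)
    show "FArr (prod_fctr C1 C2 F1 F2) u \<in>
        Hom (D1 \<times>\<^sub>C D2) (FObj (prod_fctr C1 C2 F1 F2) X) (FObj (prod_fctr C1 C2 F1 F2) Y)"
      if "u \<in> Hom (C1 \<times>\<^sub>C C2) X Y" for u X Y
      using that by (cases u; cases X; cases Y)
        (auto simp: F1.source.Hom_in_Obj F2.source.Hom_in_Obj F1.FArr_in_Hom F2.FArr_in_Hom)
    show "FArr (prod_fctr C1 C2 F1 F2) (Ide (C1 \<times>\<^sub>C C2) X) =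
        Ide (D1 \<times>\<^sub>C D2) (FObj (prod_fctr C1 C2 F1 F2) X)"
      if "X \<in> Obj (C1 \<times>\<^sub>C C2)" for X
      using that
      by (auto simp: F1.FArr_Id F2.FArr_Id F1.source.Id_in_Arr F2.source.Id_in_Arr)
    show "FArr (prod_fctr C1 C2 F1 F2) (u ;;\<^bsub>C1 \<times>\<^sub>C C2\<^esub> v) =
        FArr (prod_fctr C1 C2 F1 F2) u ;;\<^bsub>D1 \<times>\<^sub>C D2\<^esub> FArr (prod_fctr C1 C2 F1 F2) v"
      if "u \<in> Hom (C1 \<times>\<^sub>C C2) X Y" "v \<in> Hom (C1 \<times>\<^sub>C C2) Y Z" for u v X Y Z
      using that by (cases u; cases v; cases X; cases Y; cases Z)
        (auto simp: F1.FArr_Comp F2.FArr_Comp F1.source.Comp_in_Arr F2.source.Comp_in_Arr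
          F1.source.Hom_in_Obj F2.source.Hom_in_Obj)
  qed
qed

text \<open>Once the arrow and its end objects are split into pairs, the naturality square is the
  pair of the two given squares.\<close>

lemma natural_transformation_prod:
  assumes "natural_transformation C1 D1 \<theta>1" and "natural_transformation C2 D2 \<theta>2"
  shows "natural_transformation (C1 \<times>\<^sub>C C2) (D1 \<times>\<^sub>C D2) (prod_ntrans C1 C2 \<theta>1 \<theta>2)"
proof -
  interpret \<theta>1: natural_transformation C1 D1 \<theta>1 by fact
  interpret \<theta>2: natural_transformation C2 D2 \<theta>2 by fact
  show ?thesis
  proof (intro natural_transformation.intro natural_transformation_axioms.intro)
    fix u X Y assume "u \<in> Hom (C1 \<times>\<^sub>C C2) X Y"
    then show "FArr (Src (prod_ntrans C1 C2 \<theta>1 \<theta>2)) u ;;\<^bsub>D1 \<times>\<^sub>C D2\<^esub>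
        Component (prod_ntrans C1 C2 \<theta>1 \<theta>2) Y =
        Component (prod_ntrans C1 C2 \<theta>1 \<theta>2) X ;;\<^bsub>D1 \<times>\<^sub>C D2\<^esub>
        FArr (Trg (prod_ntrans C1 C2 \<theta>1 \<theta>2)) u"
      by (cases u; cases X; cases Y)
        (auto simp: \<theta>1.natural \<theta>2.natural
          \<theta>1.source.source.Hom_in_Obj \<theta>2.source.source.Hom_in_Obj)
  qed (auto simp: \<theta>1.Component_in_Hom \<theta>2.Component_in_Hom
      intro: category_functor_prod \<theta>1.source.category_functor_axioms
        \<theta>1.target.category_functor_axioms \<theta>2.source.category_functor_axioms
        \<theta>2.target.category_functor_axioms)
qed

lemma prod_ntrans_Ide:
  "prod_ntrans C1 C2 (Ide (functor_cat C1 D1) F1) (Ide (functor_cat C2 D2) F2) =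
    Ide (functor_cat (C1 \<times>\<^sub>C C2) (D1 \<times>\<^sub>C D2)) (prod_fctr C1 C2 F1 F2)"
  by (rule ntrans_eqI[of _ _ "Obj C1 \<times> Obj C2"]) auto

text \<open>The interchange of products with vertical composition: both sides are restricted to
  pairs of objects, and there both give the pair of composites. With \<open>prod_ntrans_Ide\<close>
  it is what makes the parallel get functorial in the parameter.\<close>

lemma prod_ntrans_Comp:
  "prod_ntrans C1 C2 (\<theta>1 ;;\<^bsub>functor_cat C1 D1\<^esub> \<eta>1) (\<theta>2 ;;\<^bsub>functor_cat C2 D2\<^esub> \<eta>2) =
    prod_ntrans C1 C2 \<theta>1 \<theta>2 ;;\<^bsub>functor_cat (C1 \<times>\<^sub>C C2) (D1 \<times>\<^sub>C D2)\<^esub> prod_ntrans C1 C2 \<eta>1 \<eta>2"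
  by (rule ntrans_eqI[of _ _ "Obj C1 \<times> Obj C2"]) auto

section \<open>Parallel composition of lenses\<close>

lemma par_lens_simps [simp]:
  "p1 \<in> Obj P1 \<Longrightarrow> p2 \<in> Obj P2 \<Longrightarrow> FObj (get (par_lens P1 P2 S1 S2 l1 l2)) (p1, p2) =
    prod_fctr S1 S2 (FObj (get l1) p1) (FObj (get l2) p2)"
  "e1 \<in> Arr P1 \<Longrightarrow> e2 \<in> Arr P2 \<Longrightarrow> FArr (get (par_lens P1 P2 S1 S2 l1 l2)) (e1, e2) =
    prod_ntrans S1 S2 (FArr (get l1) e1) (FArr (get l2) e2)"
  "put_upd (par_lens P1 P2 S1 S2 l1 l2) (p1, p2) (X1, X2) (v1, v2) =
    (put_upd l1 p1 X1 v1, put_upd l2 p2 X2 v2)"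
  "put_req (par_lens P1 P2 S1 S2 l1 l2) (p1, p2) (X1, X2) (v1, v2) =
    (put_req l1 p1 X1 v1, put_req l2 p2 X2 v2)"
  "put_self (par_lens P1 P2 S1 S2 l1 l2) (p1, p2) (X1, X2) (v1, v2) =
    (put_self l1 p1 X1 v1, put_self l2 p2 X2 v2)"
  by (simp_all add: par_lens_def)

lemma category_functor_get_par_lens:
  assumes "category_functor P1 (functor_cat S1 T1) (get l1)"
    and "category_functor P2 (functor_cat S2 T2) (get l2)"
    and "category S1" and "category S2" and "category T1" and "category T2"
  shows "category_functor (P1 \<times>\<^sub>C P2) (functor_cat (S1 \<times>\<^sub>C S2) (T1 \<times>\<^sub>C T2))
    (get (par_lens P1 P2 S1 S2 l1 l2))"
proof -
  interpret G1: category_functor P1 "functor_cat S1 T1" "get l1" by fact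
  interpret G2: category_functor P2 "functor_cat S2 T2" "get l2" by fact
  interpret P: category "P1 \<times>\<^sub>C P2"
    by (intro category_prod_cat G1.source.category_axioms G2.source.category_axioms)
  interpret F: category "functor_cat (S1 \<times>\<^sub>C S2) (T1 \<times>\<^sub>C T2)"
    using assms by (intro category_functor_cat category_prod_cat)
  let ?l = "par_lens P1 P2 S1 S2 l1 l2" and ?F = "functor_cat (S1 \<times>\<^sub>C S2) (T1 \<times>\<^sub>C T2)"
  show ?thesis
  proof
    show "FObj (get ?l) \<in> Obj (P1 \<times>\<^sub>C P2) \<rightarrow>\<^sub>E Obj ?F"
      using G1.FObj_in_PiE G2.FObj_in_PiE
      by (auto simp: par_lens_def intro!: category_functor_prod)
    show "FArr (get ?l) \<in> Arr (P1 \<times>\<^sub>C P2) \<rightarrow>\<^sub>E Arr ?F"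
      using G1.FArr_in_PiE G2.FArr_in_PiE
      by (auto simp: par_lens_def intro!: natural_transformation_prod)
    show "FArr (get ?l) e \<in> Hom ?F (FObj (get ?l) p) (FObj (get ?l) q)"
      if "e \<in> Hom (P1 \<times>\<^sub>C P2) p q" for e p q
    proof -
      obtain e1 e2 p1 p2 q1 q2 where eq: "e = (e1, e2)" "p = (p1, p2)" "q = (q1, q2)"
        by (cases e, cases p, cases q)
      have e: "e1 \<in> Hom P1 p1 q1" "e2 \<in> Hom P2 p2 q2"
        using that by (simp_all add: eq)
      from e show ?thesis
        using G1.FArr_in_Hom[OF e(1)] G2.FArr_in_Hom[OF e(2)]
        by (auto simp: eq Hom_iff G1.source.Dom_in_Obj G1.source.Cod_in_Obj
            G2.source.Dom_in_Obj G2.source.Cod_in_Obj intro!: natural_transformation_prod)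
    qed
    \<comment> \<open>In this and the next goal, \<open>functor_cat_simps\<close> is switched off so
      that identities and composites of the functor category stay folded and
      \<open>prod_ntrans_Ide\<close> and \<open>prod_ntrans_Comp\<close> can match.\<close>
    show "FArr (get ?l) (Ide (P1 \<times>\<^sub>C P2) p) = Ide ?F (FObj (get ?l) p)"
      if "p \<in> Obj (P1 \<times>\<^sub>C P2)" for p
      using that by (auto simp: G1.FArr_Id G2.FArr_Id G1.source.Id_in_Arr G2.source.Id_in_Arr
          prod_ntrans_Ide simp del: functor_cat_simps)
    show "FArr (get ?l) (e ;;\<^bsub>P1 \<times>\<^sub>C P2\<^esub> f) = FArr (get ?l) e ;;\<^bsub>?F\<^esub> FArr (get ?l) f"
      if "e \<in> Hom (P1 \<times>\<^sub>C P2) p q" "f \<in> Hom (P1 \<times>\<^sub>C P2) q r" for e f p q r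
      using that by (cases e; cases f; cases p; cases q; cases r)
        (auto simp: G1.FArr_Comp G2.FArr_Comp G1.source.Comp_in_Arr G2.source.Comp_in_Arr
          G1.source.Hom_in_Obj G2.source.Hom_in_Obj prod_ntrans_Comp simp del: functor_cat_simps)
  qed
qed

lemma ala_lens_par_lens:
  assumes "ala_lens P1 S1 T1 l1" and "ala_lens P2 S2 T2 l2"
  shows "ala_lens (P1 \<times>\<^sub>C P2) (S1 \<times>\<^sub>C S2) (T1 \<times>\<^sub>C T2) (par_lens P1 P2 S1 S2 l1 l2)"
proof -
  interpret l1: ala_lens P1 S1 T1 l1 by fact
  interpret l2: ala_lens P2 S2 T2 l2 by fact
  have cats: "category P1" "category P2" "category S1" "category S2" "category T1" "category T2"
    using assms by (simp_all add: ala_lens_def)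
  let ?l = "par_lens P1 P2 S1 S2 l1 l2"
  have "category_functor (P1 \<times>\<^sub>C P2) (functor_cat (S1 \<times>\<^sub>C S2) (T1 \<times>\<^sub>C T2)) (get ?l)"
    using cats l1.get.category_functor_axioms l2.get.category_functor_axioms
    by (intro category_functor_get_par_lens)
  moreover have "ala_lens_axioms (P1 \<times>\<^sub>C P2) (S1 \<times>\<^sub>C S2) (T1 \<times>\<^sub>C T2) ?l"
  proof
    fix p X v Y
    assume p: "p \<in> Obj (P1 \<times>\<^sub>C P2)" and X: "X \<in> Obj (S1 \<times>\<^sub>C S2)"
      and v: "v \<in> Hom (T1 \<times>\<^sub>C T2) (get_obj ?l p X) Y"
    obtain p1 p2 X1 X2 v1 v2 Y1 Y2
      where eq: "p = (p1, p2)" "X = (X1, X2)" "v = (v1, v2)" "Y = (Y1, Y2)"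
      by (cases p, cases X, cases v, cases Y)
    have 1: "p1 \<in> Obj P1" "X1 \<in> Obj S1" "v1 \<in> Hom T1 (get_obj l1 p1 X1) Y1"
      and 2: "p2 \<in> Obj P2" "X2 \<in> Obj S2" "v2 \<in> Hom T2 (get_obj l2 p2 X2) Y2"
      using p X v by (simp_all add: eq)
    note puts = l1.put_upd_Arr[OF 1] l1.put_req_Arr[OF 1] l2.put_upd_Arr[OF 2] l2.put_req_Arr[OF 2]
    show "put_upd ?l p X v \<in> Arr (P1 \<times>\<^sub>C P2) \<and> Dom (P1 \<times>\<^sub>C P2) (put_upd ?l p X v) = p"
      and "put_req ?l p X v \<in> Arr (S1 \<times>\<^sub>C S2) \<and> Dom (S1 \<times>\<^sub>C S2) (put_req ?l p X v) = X"
      using puts by (simp_all add: eq)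
    \<comment> \<open>The codomain of the self put is the parallel get at the updated parameter and
      source; it splits into a pair only once these are known to be objects.\<close>
    have "Cod P1 (put_upd l1 p1 X1 v1) \<in> Obj P1" "Cod S1 (put_req l1 p1 X1 v1) \<in> Obj S1"
      "Cod P2 (put_upd l2 p2 X2 v2) \<in> Obj P2" "Cod S2 (put_req l2 p2 X2 v2) \<in> Obj S2"
      using puts by (simp_all add: cats[THEN category.Cod_in_Obj])
    then show "put_self ?l p X v \<in> Hom (T1 \<times>\<^sub>C T2) Y
        (get_obj ?l (Cod (P1 \<times>\<^sub>C P2) (put_upd ?l p X v)) (Cod (S1 \<times>\<^sub>C S2) (put_req ?l p X v)))"
      using l1.put_self_in_Hom[OF 1] l2.put_self_in_Hom[OF 2] by (simp add: eq)
  qed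
  ultimately show ?thesis
    using cats by (intro ala_lens.intro category_prod_cat)
qed

text \<open>Both factors of the composite defining \<open>get_along\<close> split: the component is
  taken at a pair of domains and the functor at a pair of codomains. These are objects because the
  given coordinates are arrows.\<close>

lemma get_along_par_lens:
  assumes "category P1" and "category P2" and "category S1" and "category S2"
    and "e1 \<in> Arr P1" and "e2 \<in> Arr P2" and "u1 \<in> Arr S1" and "u2 \<in> Arr S2"
  shows "get_along (P1 \<times>\<^sub>C P2) (S1 \<times>\<^sub>C S2) (T1 \<times>\<^sub>C T2) (par_lens P1 P2 S1 S2 l1 l2)
      (e1, e2) (u1, u2) = (get_along P1 S1 T1 l1 e1 u1, get_along P2 S2 T2 l2 e2 u2)"
  using assms by (simp add: get_along_def category.Dom_in_Obj category.Cod_in_Obj)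

lemma well_behaved_par_lens:
  assumes "well_behaved_ala_lens P1 S1 T1 l1" and "well_behaved_ala_lens P2 S2 T2 l2"
  shows "well_behaved_ala_lens (P1 \<times>\<^sub>C P2) (S1 \<times>\<^sub>C S2) (T1 \<times>\<^sub>C T2)
    (par_lens P1 P2 S1 S2 l1 l2)"
proof -
  interpret l1: well_behaved_ala_lens P1 S1 T1 l1 by fact
  interpret l2: well_behaved_ala_lens P2 S2 T2 l2 by fact
  have cats: "category P1" "category P2" "category S1" "category S2"
    using l1.ala_lens_axioms l2.ala_lens_axioms by (simp_all add: ala_lens_def)
  let ?l = "par_lens P1 P2 S1 S2 l1 l2"
  have "well_behaved_ala_lens_axioms (P1 \<times>\<^sub>C P2) (S1 \<times>\<^sub>C S2) (T1 \<times>\<^sub>C T2) ?l"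
  proof
    fix p X v Y
    assume p: "p \<in> Obj (P1 \<times>\<^sub>C P2)" and X: "X \<in> Obj (S1 \<times>\<^sub>C S2)"
      and v: "v \<in> Hom (T1 \<times>\<^sub>C T2) (get_obj ?l p X) Y"
    obtain p1 p2 X1 X2 v1 v2 Y1 Y2
      where eq: "p = (p1, p2)" "X = (X1, X2)" "v = (v1, v2)" "Y = (Y1, Y2)"
      by (cases p, cases X, cases v, cases Y)
    have 1: "p1 \<in> Obj P1" "X1 \<in> Obj S1" "v1 \<in> Hom T1 (get_obj l1 p1 X1) Y1"
      and 2: "p2 \<in> Obj P2" "X2 \<in> Obj S2" "v2 \<in> Hom T2 (get_obj l2 p2 X2) Y2"
      using p X v by (simp_all add: eq)
    show "get_along (P1 \<times>\<^sub>C P2) (S1 \<times>\<^sub>C S2) (T1 \<times>\<^sub>C T2) ?l (put_upd ?l p X v) (put_req ?l p X v) =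
        v ;;\<^bsub>T1 \<times>\<^sub>C T2\<^esub> put_self ?l p X v"
      \<comment> \<open>The put typings supply the arrow conditions of
        \<open>get_along_par_lens\<close>; both sides then become pairs, matched by the two Putget
        laws.\<close>
      using l1.put_upd_Arr[OF 1] l1.put_req_Arr[OF 1] l2.put_upd_Arr[OF 2] l2.put_req_Arr[OF 2]
      by (simp add: eq get_along_par_lens[OF cats] l1.putget[OF 1] l2.putget[OF 2])
  \<comment> \<open>Stability remains: the identity at a pair is the pair of identities, so each
    coordinate is a Stability law of one factor.\<close>
  qed (auto simp: l1.stability_upd l2.stability_upd l1.stability_req l2.stability_req
      l1.stability_self l2.stability_self)
  then show ?thesis
    by (intro well_behaved_ala_lens.intro ala_lens_par_lens
        l1.ala_lens_axioms l2.ala_lens_axioms)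
qed

theorem theorem2:
  fixes P1 :: "('po1, 'pa1) cat" and P2 :: "('po2, 'pa2) cat"
    and A1 :: "('ao1, 'aa1) cat" and A2 :: "('ao2, 'aa2) cat"
    and B1 :: "('bo1, 'ba1) cat" and B2 :: "('bo2, 'ba2) cat"
    and l1 :: "('po1, 'pa1, 'ao1, 'aa1, 'bo1, 'ba1) lens"
    and l2 :: "('po2, 'pa2, 'ao2, 'aa2, 'bo2, 'ba2) lens"
  assumes "ala_lens P1 A1 B1 l1" and "ala_lens P2 A2 B2 l2"
  shows "ala_lens (P1 \<times>\<^sub>C P2) (A1 \<times>\<^sub>C A2) (B1 \<times>\<^sub>C B2) (par_lens P1 P2 A1 A2 l1 l2) \<and>
    (well_behaved_ala_lens P1 A1 B1 l1 \<and> well_behaved_ala_lens P2 A2 B2 l2 \<longrightarrow>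
     well_behaved_ala_lens (P1 \<times>\<^sub>C P2) (A1 \<times>\<^sub>C A2) (B1 \<times>\<^sub>C B2) (par_lens P1 P2 A1 A2 l1 l2))"
  using ala_lens_par_lens[OF assms] well_behaved_par_lens by blast

end
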